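(* Let $G=(V,E)$ be a $k$-regular graph on the vertices $v_1,v_2,\dotsc,v_{2n}$, fix a proper edge coloring (reference coloring) $c_0\colon E\to\{1,\dotsc,k\}$, and let $\operatorname{sgn}$ be defined relative to $c_0$ as in the context. Let $F=\{F_1,F_2,\dotsc,F_k\}$ be a 1-factorization of $G$. Then $$\operatorname{sgn}(F)=\prod_{i=1}^k\operatorname{sgn}(F_i).$$ Equivalently, for every proper edge coloring $c\colon E\to\{1,\dotsc,k\}$ we have $\operatorname{sgn}(c)=(-1)^{\operatorname{int}(c)}$, where $\operatorname{int}(c)$ is the number of intersections between edges of equal color when the vertices $v_1,\dotsc,v_{2n}$ are arranged consecutively on a circle and edges are drawn as straight line segments.
   Context: A 1-factor is a perfect matching; a 1-factorization of a $k$-regular graph is a partition of $E$ into $k$ 1-factors. For a 1-factor $F_1=\{e_1,\dotsc,e_n\}$ with $e_m=v_{i_m}v_{j_m}$, $i_m<j_m$, say $e_m$ intersects $e_p$ if $i_m<i_p<j_m<j_p$ or $i_p<i_m<j_p<j_m$; let $\operatorname{int}(F_1)$ be the number of unordered intersecting pairs of edges in $F_1$ and $\operatorname{sgn}(F_1):=(-1)^{\operatorname{int}(F_1)}$. For a proper edge coloring $c\colon E\to\{1,\dotsc,k\}$, $\operatorname{int}(c):=\sum_{\alpha=1}^k\operatorname{int}(c^{-1}(\{\alpha\}))$ (each color class is a 1-factor). For proper edge colorings $c,c_0$ and a vertex $v$ with incident edge set $E(v)$, both $c|_{E(v)}$ and $c_0|_{E(v)}$ are bijections $E(v)\to\{1,\dotsc,k\}$;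 set $\operatorname{sgn}_v(c,c_0):=\operatorname{sgn}\big((c_0|_{E(v)})^{-1}\circ c|_{E(v)}\big)$ (sign of a permutation of $E(v)$) and $\operatorname{sgn}(c,c_0):=\prod_{v\in V}\operatorname{sgn}_v(c,c_0)$. Define $\operatorname{sgn}(c_0):=(-1)^{\operatorname{int}(c_0)}$ and $\operatorname{sgn}(c):=\operatorname{sgn}(c,c_0)\operatorname{sgn}(c_0)$. For a 1-factorization $F$, $\operatorname{sgn}(F):=\operatorname{sgn}(c)$ for any proper edge coloring $c$ whose color classes are exactly the members of $F$ (this does not depend on the choice of $c$). *)

theory Defs
  imports
    "HOL-Analysis.Analysis"
    "HOL-Combinatorics.Permutations"
    "HOL-Library.Disjoint_Sets"
begin

text \<open>
  Finite simple graphs: a vertex set \<open>V\<close> and a set \<open>E\<close> of two-element subsets of \<open>V\<close>.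
  The labelling \<open>v\<^sub>1, \<dots>, v\<^sub>2\<^sub>n\<close> of the vertices is a function \<open>v\<close> that is a bijection from
  \<open>{1..2*n}\<close> to \<open>V\<close>; its values at other arguments are never used.
\<close>

definition simple_graph :: "'a set \<Rightarrow> 'a set set \<Rightarrow> bool" where
  "simple_graph V E \<longleftrightarrow> finite V \<and> (\<forall>e\<in>E. e \<subseteq> V \<and> card e = 2)"

definition incident_edges :: "'a set set \<Rightarrow> 'a \<Rightarrow> 'a set set" where
  "incident_edges E x = {e \<in> E. x \<in> e}"

definition regular_graph :: "nat \<Rightarrow> 'a set \<Rightarrow> 'a set set \<Rightarrow> bool" where
  "regular_graph k V E \<longleftrightarrow> simple_graph V E \<and> (\<forall>x\<in>V. card (incident_edges E x) = k)"

definition one_factor :: "'a set \<Rightarrow> 'a set set \<Rightarrow> 'a set set \<Rightarrow> bool" where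
  "one_factor V E M \<longleftrightarrow> M \<subseteq> E \<and> (\<forall>x\<in>V. \<exists>!e. e \<in> M \<and> x \<in> e)"

definition one_factorization :: "nat \<Rightarrow> 'a set \<Rightarrow> 'a set set \<Rightarrow> 'a set set set \<Rightarrow> bool" where
  "one_factorization k V E F \<longleftrightarrow>
     partition_on E F \<and> card F = k \<and> (\<forall>M\<in>F. one_factor V E M)"

definition proper_edge_coloring :: "nat \<Rightarrow> 'a set set \<Rightarrow> ('a set \<Rightarrow> nat) \<Rightarrow> bool" where
  "proper_edge_coloring k E c \<longleftrightarrow>
     c \<in> E \<rightarrow> {1..k} \<and> (\<forall>e\<in>E. \<forall>f\<in>E. e \<noteq> f \<and> e \<inter> f \<noteq> {} \<longrightarrow> c e \<noteq> c f)"

definition color_class :: "'a set set \<Rightarrow> ('a set \<Rightarrow> nat) \<Rightarrow> nat \<Rightarrow> 'a set set" where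
  "color_class E c \<alpha> = {e \<in> E. c e = \<alpha>}"

definition edges_intersect :: "nat \<Rightarrow> (nat \<Rightarrow> 'a) \<Rightarrow> 'a set \<Rightarrow> 'a set \<Rightarrow> bool" where
  "edges_intersect n v e f \<longleftrightarrow>
     (\<exists>i j p q. {i, j, p, q} \<subseteq> {1..2*n} \<and> e = {v i, v j} \<and> f = {v p, v q} \<and> i < j \<and> p < q \<and>
        (i < p \<and> p < j \<and> j < q \<or> p < i \<and> i < q \<and> q < j))"

definition int_factor :: "nat \<Rightarrow> (nat \<Rightarrow> 'a) \<Rightarrow> 'a set set \<Rightarrow> nat" where
  "int_factor n v M = card {{e, f} | e f. e \<in> M \<and> f \<in> M \<and> edges_intersect n v e f}"

definition sgn_factor :: "nat \<Rightarrow> (nat \<Rightarrow> 'a) \<Rightarrow> 'a set set \<Rightarrow> int" where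
  "sgn_factor n v M = (- 1) ^ int_factor n v M"

definition int_coloring ::
    "nat \<Rightarrow> (nat \<Rightarrow> 'a) \<Rightarrow> nat \<Rightarrow> 'a set set \<Rightarrow> ('a set \<Rightarrow> nat) \<Rightarrow> nat" where
  "int_coloring n v k E c = (\<Sum>\<alpha>=1..k. int_factor n v (color_class E c \<alpha>))"

definition sgn_vertex ::
    "'a set set \<Rightarrow> ('a set \<Rightarrow> nat) \<Rightarrow> ('a set \<Rightarrow> nat) \<Rightarrow> 'a \<Rightarrow> int" where
  "sgn_vertex E c c0 x =
     sign_on (incident_edges E x) (inv_into (incident_edges E x) c0 \<circ> c)"

definition sgn_rel ::
    "'a set \<Rightarrow> 'a set set \<Rightarrow> ('a set \<Rightarrow> nat) \<Rightarrow> ('a set \<Rightarrow> nat) \<Rightarrow> int" where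
  "sgn_rel V E c c0 = (\<Prod>x\<in>V. sgn_vertex E c c0 x)"

text \<open>
  In \<open>sgn_coloring\<close> and \<open>sgn_factorization\<close>, \<open>c0\<close> is the reference coloring.
\<close>

definition sgn_coloring ::
    "nat \<Rightarrow> (nat \<Rightarrow> 'a) \<Rightarrow> nat \<Rightarrow> 'a set \<Rightarrow> 'a set set \<Rightarrow> ('a set \<Rightarrow> nat) \<Rightarrow> ('a set \<Rightarrow> nat) \<Rightarrow> int" where
  "sgn_coloring n v k V E c0 c = sgn_rel V E c c0 * (- 1) ^ int_coloring n v k E c0"

text \<open>
  The description below denotes the common value of the signs of all colorings whose color
  classes are the members of \<open>F\<close>; it is meaningful only if that value is the same for all of them.
\<close>

definition sgn_factorization ::
    "nat \<Rightarrow> (nat \<Rightarrow> 'a) \<Rightarrow> nat \<Rightarrow> 'a set \<Rightarrow> 'a set set \<Rightarrow> ('a set \<Rightarrow> nat) \<Rightarrow> 'a set set set \<Rightarrow> int" where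
  "sgn_factorization n v k V E c0 F =
     (THE s. \<exists>c. proper_edge_coloring k E c \<and> color_class E c ` {1..k} = F \<and>
               s = sgn_coloring n v k V E c0 c)"

text \<open>
  Positions \<open>P\<close> of the vertices in the plane such that \<open>v\<^sub>1, \<dots>, v\<^sub>2\<^sub>n\<close> lie consecutively
  (counterclockwise, not necessarily equally spaced) on some circle.
\<close>

definition consecutive_on_circle :: "nat \<Rightarrow> (nat \<Rightarrow> 'a) \<Rightarrow> ('a \<Rightarrow> complex) \<Rightarrow> bool" where
  "consecutive_on_circle n v P \<longleftrightarrow>
     (\<exists>z r \<theta>. r > 0 \<and>
        (\<forall>i\<in>{1..2*n}. P (v i) = z + of_real r * cis (\<theta> i)) \<and>
        (\<forall>i\<in>{1..2*n}. \<forall>j\<in>{1..2*n}. i < j \<longrightarrow> \<theta> i < \<theta> j \<and> \<theta> j < \<theta> i + 2 * pi))"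

text \<open>
  The convex hull of the two end points of an edge is the straight line segment drawing it.
  Intersections are counted per pair of edges, so a point common to several segments counts
  once for each pair. In a proper coloring, distinct edges of equal color share no end point.
\<close>

definition drawn_intersections ::
    "('a \<Rightarrow> complex) \<Rightarrow> 'a set set \<Rightarrow> ('a set \<Rightarrow> nat) \<Rightarrow> nat" where
  "drawn_intersections P E c =
     card {{e, f} | e f. e \<in> E \<and> f \<in> E \<and> e \<noteq> f \<and> c e = c f \<and>
                         convex hull (P ` e) \<inter> convex hull (P ` f) \<noteq> {}}"

end

theory Submission
  imports Defs "HOL-Library.Z2"
begin

text \<open>
  Work modulo 2. The crossings of equally colored edges and those of pairs \<open>e, f\<close> with
  \<open>c e < c f\<close> together make up all crossings of the graph, a number independent of \<open>c\<close>.
  Two disjoint edges cross iff the number of pairs \<open>x \<in> e\<close>, \<open>y \<in> f\<close> with \<open>y\<close> before \<open>x\<close> is odd.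
  Summed over all pairs with \<open>c e < c f\<close>, adjacent or not, the number of such pairs is again
  independent of \<open>c\<close>, since every color occurs exactly once at every vertex. The error made
  at edges \<open>{s, t}\<close> and \<open>{s, u}\<close> is \<open>[s < t] + [u < s] + [u < t]\<close>; its first two terms
  sum to \<open>card E * (k - 1)\<close>, and the third counts the inversions of \<open>c\<close> at \<open>s\<close> when the edges
  there are ordered by their other ends. So \<open>int(c)\<close> and the total number of inversions differ by a
  constant, and the sign of \<open>c\<close> relative to \<open>c0\<close> at \<open>s\<close> is the product of the signs
  given by the two inversion numbers.
\<close>

text \<open>Rewriting addition of bits to exclusive or, and sums of truth values to cardinalities,
  would hide the ring structure.\<close>

declare add_bit_eq_xor [simp del] mult_bit_eq_and [simp del] sum_of_bool_eq [simp del]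

section \<open>Residues modulo 2 and signs\<close>

lemma bit_add_self [simp]: "b + b = (0 :: bit)"
  by (cases b) auto

text \<open>The isomorphism from the additive group of \<open>bit\<close> onto the group of signs;
  it turns sums of parities into products of signs.\<close>

definition parity_sign :: "bit \<Rightarrow> int" where
  "parity_sign b = (if b = 0 then 1 else - 1)"

lemma parity_sign_0 [simp]: "parity_sign 0 = 1"
  and parity_sign_1 [simp]: "parity_sign 1 = - 1"
  by (simp_all add: parity_sign_def)

lemma parity_sign_add: "parity_sign (a + b) = parity_sign a * parity_sign b"
  by (cases a; cases b) auto

lemma parity_sign_sum: "parity_sign (sum f A) = (\<Prod>x\<in>A. parity_sign (f x))"
  by (induction A rule: infinite_finite_induct) (auto simp: parity_sign_add)

lemma parity_sign_of_nat: "parity_sign (of_nat m) = (- 1) ^ m"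
  by (induction m) (auto simp: parity_sign_add)

subsection \<open>Inversions\<close>

text \<open>The inversions of \<open>c\<close>, modulo 2, when \<open>A\<close> is listed in
  increasing order of the ranking \<open>r\<close>. The condition \<open>c e < c f\<close> selects
  one orientation of each pair, so no inversion is counted twice.\<close>

definition inversion_parity ::
    "'b set \<Rightarrow> ('b \<Rightarrow> 'r::linorder) \<Rightarrow> ('b \<Rightarrow> 'c::linorder) \<Rightarrow> bit" where
  "inversion_parity A r c = (\<Sum>e\<in>A. \<Sum>f\<in>A. of_bool (c e < c f \<and> r f < r e))"

lemma inversion_parity_cong:
  "(\<And>e. e \<in> A \<Longrightarrow> c e = d e) \<Longrightarrow> inversion_parity A r c = inversion_parity A r d"
  unfolding inversion_parity_def by (intro sum.cong) auto

text \<open>The pair of \<open>x\<close> and \<open>e\<close> is an inversion iff exactly one of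
  \<open>c x < c e\<close> and \<open>r x < r e\<close> holds, and for bits "exactly one" is
  addition.\<close>

lemma inversion_parity_insert:
  assumes "finite A" "x \<notin> A" "inj_on c (insert x A)" "inj_on r (insert x A)"
  shows "inversion_parity (insert x A) r c =
    inversion_parity A r c + (\<Sum>e\<in>A. of_bool (c x < c e) + of_bool (r x < r e))"
proof -
  have "of_bool (c x < c e \<and> r e < r x) + of_bool (c e < c x \<and> r x < r e) =
      (of_bool (c x < c e) + of_bool (r x < r e) :: bit)" if "e \<in> A" for e
  proof -
    have "c x \<noteq> c e" "r x \<noteq> r e"
      using assms that by (auto simp: inj_on_def)
    then show ?thesis by (cases "c x < c e"; cases "r x < r e") auto
  qed
  then have "(\<Sum>e\<in>A. of_bool (c x < c e \<and> r e < r x)) + (\<Sum>e\<in>A. of_bool (c e < c x \<and> r x < r e)) =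
      (\<Sum>e\<in>A. of_bool (c x < c e) + of_bool (r x < r e) :: bit)"
    unfolding sum.distrib[symmetric] by (intro sum.cong) auto
  then show ?thesis
    using assms(1,2) unfolding inversion_parity_def
    by (simp add: sum.distrib algebra_simps)
qed

text \<open>Once \<open>a\<close> and \<open>b\<close> are split off, their comparisons with the
  remaining elements contribute symmetrically in the two values; only the comparison of
  \<open>a\<close> with \<open>b\<close> is reversed.\<close>

lemma inversion_parity_transpose:
  fixes c :: "'b \<Rightarrow> 'c::linorder" and r :: "'b \<Rightarrow> 'r::linorder"
  assumes "finite A" "a \<in> A" "b \<in> A" "a \<noteq> b" "inj_on c A" "inj_on r A"
  shows "inversion_parity A r (c \<circ> Transposition.transpose a b) = inversion_parity A r c + 1"
proof -
  define B where "B = A - {a, b}"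
  have A: "A = insert a (insert b B)" and B: "finite B" "a \<notin> insert b B" "b \<notin> B"
    using assms by (auto simp: B_def)
  let ?d = "c \<circ> Transposition.transpose a b"
  have inj: "inj_on ?d A"
    using assms by (intro comp_inj_on) (auto simp: inj_on_def Transposition.transpose_def)
  have eq: "?d e = c e" if "e \<in> B" for e
    using that B by (auto simp: Transposition.transpose_def)
  \<comment> \<open>Stated for arbitrary injective \<open>d\<close>, to serve for both
    \<open>c\<close> and \<open>?d\<close>.\<close>
  have expand: "inversion_parity A r d = inversion_parity B r d +
      (\<Sum>e\<in>B. of_bool (d b < d e) + of_bool (d a < d e) + of_bool (r b < r e) + of_bool (r a < r e)) +
      of_bool (d a < d b) + of_bool (r a < r b)" if "inj_on d A" for d :: "'b \<Rightarrow> 'c"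
  proof -
    have "inversion_parity A r d = inversion_parity (insert b B) r d +
        (\<Sum>e\<in>insert b B. of_bool (d a < d e) + of_bool (r a < r e))"
      using that assms B unfolding A by (intro inversion_parity_insert) auto
    moreover have "inversion_parity (insert b B) r d = inversion_parity B r d +
        (\<Sum>e\<in>B. of_bool (d b < d e) + of_bool (r b < r e))"
      using that assms B unfolding A
      by (intro inversion_parity_insert) (auto intro: inj_on_subset)
    ultimately show ?thesis
      using B by (simp add: sum.distrib algebra_simps)
  qed
  have "c a \<noteq> c b" using assms by (auto simp: inj_on_def)
  then have flip: "of_bool (c b < c a) = (of_bool (c a < c b) + 1 :: bit)"
    by auto
  have cong: "inversion_parity B r ?d = inversion_parity B r c"
    by (rule inversion_parity_cong) (rule eq)
  have sum: "(\<Sum>e\<in>B. of_bool (?d b < ?d e) + of_bool (?d a < ?d e) + of_bool (r b < r e) + of_bool (r a < r e)) =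
     (\<Sum>e\<in>B. of_bool (c b < c e) + of_bool (c a < c e) + of_bool (r b < r e) + of_bool (r a < r e) :: bit)"
    using eq by (intro sum.cong refl) (simp add: add.commute)
  show ?thesis
    unfolding expand[OF inj] expand[OF assms(5)] cong sum
    by (simp add: flip algebra_simps)
qed

text \<open>The permutation is built up by transpositions on the right, each of which reverses both
  signs.\<close>

lemma parity_sign_inversion_parity_permutes:
  assumes "finite A" "p permutes A" "inj_on c A" "inj_on r A"
  shows "parity_sign (inversion_parity A r (c \<circ> p)) = sign p * parity_sign (inversion_parity A r c)"
  using assms(1,2)
proof (induction rule: permutes_rev_induct)
  case id
  then show ?case by simp
next
  case (swap a b p)
  have inj: "inj_on (c \<circ> p) A"
    using swap.hyps assms by (intro comp_inj_on) (auto simp: permutes_image permutes_inj_on)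
  have "parity_sign (inversion_parity A r (c \<circ> p \<circ> Transposition.transpose a b)) =
      - parity_sign (inversion_parity A r (c \<circ> p))"
    using inversion_parity_transpose[OF assms(1) swap.hyps(1-3) inj assms(4)]
    by (simp add: parity_sign_add)
  moreover have "sign (p \<circ> Transposition.transpose a b) = - sign p"
    using swap.hyps assms(1)
    by (subst sign_compose)
      (auto simp: sign_swap_id permutation_swap_id intro: permutes_imp_permutation)
  ultimately show ?case
    unfolding comp_assoc[symmetric] swap.IH by (simp only: mult_minus_left)
qed

text \<open>On \<open>A\<close>, \<open>c\<close> is \<open>c0\<close> after the permutation in
  question. The relative sign thus splits into a factor for \<open>c\<close> and a factor for
  \<open>c0\<close>.\<close>

lemma sign_on_inv_into_comp:
  assumes "finite A" "bij_betw c A K" "bij_betw c0 A K" "inj_on r A"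
  shows "sign_on A (inv_into A c0 \<circ> c) =
    parity_sign (inversion_parity A r c) * parity_sign (inversion_parity A r c0)"
proof -
  \<comment> \<open>\<open>permutes\<close> demands the identity outside \<open>A\<close>, which
    \<open>restrict_id\<close> provides.\<close>
  let ?q = "restrict_id (inv_into A c0 \<circ> c) A"
  have "bij_betw (inv_into A c0 \<circ> c) A A"
    using assms bij_betw_inv_into bij_betw_trans by blast
  then have q: "?q permutes A" by (rule permutes_restrict_id)
  have "inversion_parity A r (c0 \<circ> ?q) = inversion_parity A r c"
    using assms(2,3)
    by (intro inversion_parity_cong)
      (auto simp: restrict_id_def bij_betw_def intro!: f_inv_into_f)
  then have "parity_sign (inversion_parity A r c) = sign ?q * parity_sign (inversion_parity A r c0)"
    using parity_sign_inversion_parity_permutes[OF assms(1) q _ assms(4), of c0] assms(3)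
    by (simp add: bij_betw_def)
  then show ?thesis
    by (simp add: sign_on_def parity_sign_def split: if_splits)
qed

subsection \<open>Chords of a circle\<close>

text \<open>Positive iff \<open>X\<close> lies to the left of the directed line from \<open>A\<close> to \<open>B\<close>.\<close>

definition side :: "complex \<Rightarrow> complex \<Rightarrow> complex \<Rightarrow> real" where
  "side A B X = (Re B - Re A) * (Im X - Im A) - (Im B - Im A) * (Re X - Re A)"

lemma side_convex_combination:
  "side A B ((1 - u) *\<^sub>R C + u *\<^sub>R D) = (1 - u) * side A B C + u * side A B D"
  by (simp add: side_def algebra_simps)

text \<open>\<open>side A B\<close> is affine and vanishes on the line through \<open>A\<close> and
  \<open>B\<close>; having the same strict sign at \<open>C\<close> and \<open>D\<close>, it has no
  zero between them.\<close>

lemma closed_segments_disjoint: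
  assumes "side A B C * side A B D > 0"
  shows "closed_segment A B \<inter> closed_segment C D = {}"
proof -
  have False if X: "X \<in> closed_segment A B" "X \<in> closed_segment C D" for X
  proof -
    obtain u where u: "X = (1 - u) *\<^sub>R A + u *\<^sub>R B"
      using X(1) unfolding in_segment by blast
    obtain w where w: "0 \<le> w" "w \<le> 1" "X = (1 - w) *\<^sub>R C + w *\<^sub>R D"
      using X(2) unfolding in_segment by blast
    have "side A B X = 0"
      unfolding u side_convex_combination by (simp add: side_def)
    then have zero: "(1 - w) * side A B C + w * side A B D = 0"
      unfolding w(3) side_convex_combination .
    consider "side A B C > 0" "side A B D > 0" | "side A B C < 0" "side A B D < 0"
      using assms by (auto simp: zero_less_mult_iff)
    then show False
    proof cases
      case 1
      then show ?thesis
        using zero convex_bound_lt[of "- side A B C" 0 "- side A B D" "1 - w" w] w by simp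
    next
      case 2
      then show ?thesis
        using zero convex_bound_lt[of "side A B C" 0 "side A B D" "1 - w" w] w by simp
    qed
  qed
  then show ?thesis by blast
qed

lemma closed_segments_meet:
  assumes "side A B C < 0" "0 < side A B D" "side C D B < 0" "0 < side C D A"
  shows "closed_segment A B \<inter> closed_segment C D \<noteq> {}"
proof -
  \<comment> \<open>The cross product of \<open>B - A\<close> and \<open>D - C\<close>, that is, the
    determinant of the linear system for the common point; \<open>u\<close> and \<open>w\<close>
    solve it by Cramer's rule.\<close>
  let ?d = "side A B D - side A B C"
  have d: "?d > 0" "?d = side C D A - side C D B"
    using assms by (auto simp: side_def algebra_simps)
  define u w where "u = side C D A / ?d" and "w = - side A B C / ?d"
  have ud: "u * ?d = side C D A" "w * ?d = - side A B C"
    using d by (simp_all add: u_def w_def)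
  have "0 \<le> u" "u \<le> 1"
    using assms unfolding u_def d(2) by (auto simp: divide_simps)
  moreover have "0 \<le> w" "w \<le> 1"
    using assms unfolding w_def by (auto simp: divide_simps)
  moreover have "(1 - u) *\<^sub>R A + u *\<^sub>R B = (1 - w) *\<^sub>R C + w *\<^sub>R D"
  proof -
    have "?d *\<^sub>R ((1 - u) *\<^sub>R A + u *\<^sub>R B) = (?d - u * ?d) *\<^sub>R A + (u * ?d) *\<^sub>R B"
      by (simp add: algebra_simps scaleR_add_right)
    also have "\<dots> = (?d - w * ?d) *\<^sub>R C + (w * ?d) *\<^sub>R D"
      unfolding ud by (simp add: complex_eq_iff side_def algebra_simps)
    also have "\<dots> = ?d *\<^sub>R ((1 - w) *\<^sub>R C + w *\<^sub>R D)"
      by (simp add: algebra_simps scaleR_add_right)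
    finally show ?thesis using d(1) by simp
  qed
  ultimately have "(1 - u) *\<^sub>R A + u *\<^sub>R B \<in> closed_segment A B \<inter> closed_segment C D"
    unfolding Int_iff in_segment by blast
  then show ?thesis by blast
qed

text \<open>Twice the signed area of an inscribed triangle. The sum-to-product formulas pull out two
  of the sines, and the subtraction formula supplies the third.\<close>

lemma side_circle:
  "side (z + of_real r * cis a) (z + of_real r * cis b) (z + of_real r * cis t) =
     4 * r\<^sup>2 * sin ((b - a) / 2) * sin ((t - b) / 2) * sin ((t - a) / 2)"
proof -
  have *: "(t - b) / 2 = (t + a) / 2 - (b + a) / 2" by (simp add: field_simps)
  have "side (z + of_real r * cis a) (z + of_real r * cis b) (z + of_real r * cis t) =
      r\<^sup>2 * ((cos b - cos a) * (sin t - sin a) - (sin b - sin a) * (cos t - cos a))"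
    by (simp add: side_def algebra_simps power2_eq_square)
  also have "\<dots> = r\<^sup>2 * (4 * sin ((b - a) / 2) * sin ((t - a) / 2) *
      (sin ((t + a) / 2) * cos ((b + a) / 2) - cos ((t + a) / 2) * sin ((b + a) / 2)))"
  proof -
    have "sin ((a - b) / 2) = - sin ((b - a) / 2)" "sin ((a - t) / 2) = - sin ((t - a) / 2)"
      by (metis minus_diff_eq minus_divide_left sin_minus)+
    then show ?thesis
      unfolding cos_diff_cos sin_diff_sin by (simp add: algebra_simps)
  qed
  finally show ?thesis
    unfolding * sin_diff by (simp add: algebra_simps)
qed

text \<open>All half differences of the angles have absolute value below \<open>pi\<close>, so their
  sines have the signs of the differences, and \<open>side_circle\<close> determines the side of a
  point from the order of the angles.\<close>

lemma chords_of_circle: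
  fixes z :: complex and t1 t2 t3 t4 :: real
  assumes "r > 0" "t1 < t2" "t2 < t3" "t3 < t4" "t4 < t1 + 2 * pi"
  defines "Q \<equiv> \<lambda>t. z + of_real r * cis t"
  shows crossing_chords: "closed_segment (Q t1) (Q t3) \<inter> closed_segment (Q t2) (Q t4) \<noteq> {}"
    and separated_chords: "closed_segment (Q t1) (Q t2) \<inter> closed_segment (Q t3) (Q t4) = {}"
    and nested_chords: "closed_segment (Q t1) (Q t4) \<inter> closed_segment (Q t2) (Q t3) = {}"
proof -
  have pos: "sin ((b - a) / 2) > 0" and neg: "sin ((a - b) / 2) < 0"
    if "a < b" "b < a + 2 * pi" for a b :: real
  proof -
    show "sin ((b - a) / 2) > 0" using that by (intro sin_gt_zero) auto
    moreover have "sin ((a - b) / 2) = - sin ((b - a) / 2)"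
      by (metis minus_diff_eq minus_divide_left sin_minus)
    ultimately show "sin ((a - b) / 2) < 0" by simp
  qed
  have side: "side (Q a) (Q b) (Q t) =
      4 * r\<^sup>2 * (sin ((b - a) / 2) * (sin ((t - b) / 2) * sin ((t - a) / 2)))" for a b t
    unfolding Q_def side_circle by (simp add: algebra_simps)
  have r: "4 * r\<^sup>2 > 0" using assms by simp
  \<comment> \<open>The third angle comes after both ends of the chord in \<open>left\<close>,
    before both in \<open>left'\<close>, and between them in \<open>right\<close>.\<close>
  have left: "side (Q a) (Q b) (Q t) > 0" if "a < b" "b < t" "t < a + 2 * pi" for a b t
    unfolding side using that by (intro mult_pos_pos pos r) auto
  have left': "side (Q a) (Q b) (Q t) > 0" if "t < a" "a < b" "b < t + 2 * pi" for a b t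
    unfolding side using that by (intro mult_pos_pos mult_neg_neg pos neg r) auto
  have right: "side (Q a) (Q b) (Q t) < 0" if "a < t" "t < b" "b < a + 2 * pi" for a b t
    unfolding side using that by (intro mult_pos_neg mult_neg_pos pos neg r) auto
  show "closed_segment (Q t1) (Q t3) \<inter> closed_segment (Q t2) (Q t4) \<noteq> {}"
    using assms by (intro closed_segments_meet left left' right) auto
  show "closed_segment (Q t1) (Q t2) \<inter> closed_segment (Q t3) (Q t4) = {}"
    using assms by (intro closed_segments_disjoint mult_pos_pos left) auto
  show "closed_segment (Q t1) (Q t4) \<inter> closed_segment (Q t2) (Q t3) = {}"
    using assms by (intro closed_segments_disjoint mult_neg_neg right) auto
qed

subsection \<open>Parity of the crossing number\<close>

definition other_end :: "'a set \<Rightarrow> 'a \<Rightarrow> 'a" where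
  "other_end e s = the_elem (e - {s})"

lemma other_end_insert [simp]:
  "s \<noteq> t \<Longrightarrow> other_end {s, t} s = t" "s \<noteq> t \<Longrightarrow> other_end {t, s} s = t"
  by (auto simp: other_end_def insert_Diff_if)

locale labelled_graph =
  fixes V :: "'a set" and E :: "'a set set" and v :: "nat \<Rightarrow> 'a" and n :: nat
  assumes labelling: "bij_betw v {1..2*n} V"
    and graph: "simple_graph V E"
begin

definition label :: "'a \<Rightarrow> nat" where
  "label x = inv_into {1..2*n} v x"

definition before :: "'a \<Rightarrow> 'a \<Rightarrow> bit" where
  "before x y = of_bool (label x < label y)"

lemma label_v [simp]: "i \<in> {1..2*n} \<Longrightarrow> label (v i) = i"
  using labelling unfolding label_def by (intro inv_into_f_f) (auto simp: bij_betw_def)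

lemma v_label [simp]: "x \<in> V \<Longrightarrow> v (label x) = x"
  using labelling unfolding label_def by (intro f_inv_into_f) (auto simp: bij_betw_def)

lemma label_in: "x \<in> V \<Longrightarrow> label x \<in> {1..2*n}"
  using labelling unfolding label_def by (intro inv_into_into) (auto simp: bij_betw_def)

lemma inj_on_label: "inj_on label V"
  by (metis inj_onI v_label)

lemma finite_V [simp]: "finite V"
  using graph by (simp add: simple_graph_def)

lemma edge_subset: "e \<in> E \<Longrightarrow> e \<subseteq> V"
  using graph by (simp add: simple_graph_def)

lemma finite_edge [simp]: "e \<in> E \<Longrightarrow> finite e"
  using edge_subset finite_V finite_subset by blast

lemma finite_E [simp]: "finite E"
  by (rule finite_subset[of _ "Pow V"]) (use edge_subset in auto)

lemma finite_incident_edges [simp]: "finite (incident_edges E x)"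
  by (simp add: incident_edges_def)

lemma edgeE:
  assumes "e \<in> E"
  obtains a b where "e = {a, b}" "a \<in> V" "b \<in> V" "label a < label b"
proof -
  obtain a b where ab: "e = {a, b}" "a \<noteq> b"
    using assms graph by (auto simp: simple_graph_def card_2_iff)
  then have V: "a \<in> V" "b \<in> V"
    using edge_subset[OF assms] by auto
  then have "label a \<noteq> label b"
    using ab inj_on_label by (auto simp: inj_on_def)
  then show thesis
    using that[of a b] that[of b a] ab V by (metis insert_commute linorder_neqE_nat)
qed

lemma incident_edgeE:
  assumes "e \<in> incident_edges E s"
  obtains t where "e = {s, t}" "s \<noteq> t" "s \<in> V" "t \<in> V" "other_end e s = t"
proof -
  have e: "e \<in> E" "s \<in> e" using assms by (auto simp: incident_edges_def)
  obtain a b where ab: "e = {a, b}" "a \<in> V" "b \<in> V" "label a < label b"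
    using edgeE[OF e(1)] by metis
  then show thesis
    using that[of a] that[of b] e by (auto simp: insert_commute)
qed

text \<open>Makes the label of the other end a valid ranking \<open>r\<close> of the edges at
  \<open>s\<close>: in a simple graph, this end determines the edge.\<close>

lemma inj_on_other_end: "inj_on (\<lambda>e. label (other_end e s)) (incident_edges E s)"
proof (rule inj_onI)
  fix e f assume "e \<in> incident_edges E s" "f \<in> incident_edges E s"
    and eq: "label (other_end e s) = label (other_end f s)"
  then obtain t u where "e = {s, t}" "other_end e s = t" "t \<in> V"
      "f = {s, u}" "other_end f s = u" "u \<in> V"
    by (metis incident_edgeE)
  with eq show "e = f" by (metis v_label)
qed

text \<open>The labels of the end points, ordered within each edge, are the only possible witnesses
  for the indices.\<close>

lemma edges_intersect_iff:
  assumes "a \<in> V" "b \<in> V" "p \<in> V" "q \<in> V" "label a < label b" "label p < label q"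
  shows "edges_intersect n v {a, b} {p, q} \<longleftrightarrow>
    label a < label p \<and> label p < label b \<and> label b < label q \<or>
    label p < label a \<and> label a < label q \<and> label q < label b"
    (is "?L \<longleftrightarrow> ?R")
proof
  assume ?L
  then obtain i j l m where ij: "{i, j, l, m} \<subseteq> {1..2*n}" "{a, b} = {v i, v j}"
      "{p, q} = {v l, v m}" "i < j" "l < m"
      and R: "i < l \<and> l < j \<and> j < m \<or> l < i \<and> i < m \<and> m < j"
    unfolding edges_intersect_def by blast
  then have lab: "label (v i) = i" "label (v j) = j" "label (v l) = l" "label (v m) = m"
    by auto
  have "a = v i" "b = v j"
    using ij(2,4) lab assms(5) by (auto simp: doubleton_eq_iff)
  moreover have "p = v l" "q = v m"
    using ij(3,5) lab assms(6) by (auto simp: doubleton_eq_iff)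
  ultimately show ?R using R lab by simp
next
  assume ?R
  then show ?L
    unfolding edges_intersect_def using assms label_in v_label
    by (intro exI[of _ "label a"] exI[of _ "label b"] exI[of _ "label p"] exI[of _ "label q"]) simp
qed

lemma edges_intersect_sym: "edges_intersect n v e f \<Longrightarrow> edges_intersect n v f e"
  unfolding edges_intersect_def by blast

lemma edges_intersect_irrefl: "e \<in> E \<Longrightarrow> \<not> edges_intersect n v e e"
  by (metis edgeE edges_intersect_iff less_irrefl)

text \<open>For disjoint edges, the first sum is the number of endpoints of \<open>f\<close> between those of
  \<open>e\<close>, modulo 2; the second sum removes the error made for adjacent edges.\<close>

lemma edges_intersect_parity:
  assumes "e \<in> E" "f \<in> E" "e \<noteq> f"
  shows "of_bool (edges_intersect n v e f) = (\<Sum>x\<in>e. \<Sum>y\<in>f. before y x) +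
    (\<Sum>s\<in>e \<inter> f. before s (other_end e s) + before (other_end f s) s +
       before (other_end f s) (other_end e s))"
proof -
  obtain a b where e: "e = {a, b}" "a \<in> V" "b \<in> V" "label a < label b"
    using edgeE[OF assms(1)] by metis
  obtain p q where f: "f = {p, q}" "p \<in> V" "q \<in> V" "label p < label q"
    using edgeE[OF assms(2)] by metis
  have eqI: "x = y \<longleftrightarrow> label x = label y" if "x \<in> V" "y \<in> V" for x y
    using that inj_on_label by (auto simp: inj_on_def)
  have ne: "a \<noteq> b" "p \<noteq> q" "b \<noteq> a" "q \<noteq> p" using e f by auto
  \<comment> \<open>Distinct edges share at most one vertex: four ways to be adjacent, and the
    disjoint case. Each reduces to comparing labels.\<close>
  consider "a = p" "b \<noteq> q" | "a = q" | "b = p" | "b = q" "a \<noteq> p"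
    | "a \<noteq> p" "a \<noteq> q" "b \<noteq> p" "b \<noteq> q"
    using assms e f by auto
  then show ?thesis
  proof cases
    case 1
    then have int: "e \<inter> f = {a}" using e f by auto
    show ?thesis
      unfolding int using 1 e(2-) f(2-) ne unfolding e(1) f(1)
      by (subst edges_intersect_iff) (auto simp: before_def)
  next
    case 2
    then have int: "e \<inter> f = {a}" using e f by auto
    show ?thesis
      unfolding int using 2 e(2-) f(2-) ne unfolding e(1) f(1)
      by (subst edges_intersect_iff) (auto simp: before_def)
  next
    case 3
    then have int: "e \<inter> f = {b}" using e f by auto
    show ?thesis
      unfolding int using 3 e(2-) f(2-) ne unfolding e(1) f(1)
      by (subst edges_intersect_iff) (auto simp: before_def)
  next
    case 4
    then have int: "e \<inter> f = {b}" using e f by auto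
    show ?thesis
      unfolding int using 4 e(2-) f(2-) ne unfolding e(1) f(1)
      by (subst edges_intersect_iff) (auto simp: before_def)
  next
    case 5
    then have int: "e \<inter> f = {}" using e f by auto
    have "label a \<noteq> label p" "label a \<noteq> label q" "label b \<noteq> label p" "label b \<noteq> label q"
      using 5 e f eqI by blast+
    then show ?thesis
      unfolding int using e(2-) f(2-) ne unfolding e(1) f(1)
      by (subst edges_intersect_iff) (auto simp: before_def)
  qed
qed

text \<open>Double counting of incidences.\<close>

lemma sum_edges_vertices:
  "(\<Sum>e\<in>E. \<Sum>x\<in>e. g e x) = (\<Sum>x\<in>V. \<Sum>e\<in>incident_edges E x. g e x)"
proof -
  have "(\<Sum>e\<in>E. \<Sum>x\<in>e. g e x) = (\<Sum>e\<in>E. \<Sum>x | x \<in> V \<and> x \<in> e. g e x)"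
    using edge_subset by (intro sum.cong) auto
  also have "\<dots> = (\<Sum>x\<in>V. \<Sum>e | e \<in> E \<and> x \<in> e. g e x)"
    by (rule sum.swap_restrict) auto
  finally show ?thesis by (simp add: incident_edges_def)
qed

text \<open>The first two summands on the right do not mention \<open>c\<close>, so the coloring
  enters only through its inversions. The subtraction in \<open>k - 1\<close> is never truncated
  where \<open>hh\<close> is applied, since a color in \<open>{1..k}\<close> exists there.\<close>

lemma bicolored_intersections_parity:
  assumes bij: "\<And>x. x \<in> V \<Longrightarrow> bij_betw c (incident_edges E x) {1..k::nat}"
  shows "(\<Sum>e\<in>E. \<Sum>f\<in>E. of_bool (c e < c f) * of_bool (edges_intersect n v e f)) =
    (\<Sum>x\<in>V. \<Sum>y\<in>V. before y x * (\<Sum>i\<in>{1..k}. \<Sum>j\<in>{1..k}. of_bool (i < j))) +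
    of_nat (card E * (k - 1)) +
    (\<Sum>s\<in>V. inversion_parity (incident_edges E s) (\<lambda>e. label (other_end e s)) c)"
proof -
  let ?I = "incident_edges E"
  let ?o = "\<lambda>e f. of_bool (c e < c f) :: bit"
  let ?g = "\<lambda>s e f. before s (other_end e s) + before (other_end f s) s +
       before (other_end f s) (other_end e s)"
  \<comment> \<open>Modulo 2, \<open>h i\<close> counts the colors above \<open>i\<close> and
    \<open>h'\<close> those below, together all colors but \<open>i\<close>.\<close>
  define h where "h = (\<lambda>i. \<Sum>j\<in>{1..k}. of_bool (i < j) :: bit)"
  define h' where "h' = (\<lambda>i. \<Sum>j\<in>{1..k}. of_bool (j < i) :: bit)"
  \<comment> \<open>Every color occurs exactly once at \<open>x\<close>, so summing a function of
    the color over the edges there removes \<open>c\<close>.\<close>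
  have re: "(\<Sum>e\<in>?I x. u (c e)) = (\<Sum>i\<in>{1..k}. u i)" if "x \<in> V" for x and u :: "nat \<Rightarrow> bit"
    using sum.reindex_bij_betw[OF bij[OF that], of u] .
  have hh: "h i + h' i = of_nat (k - 1)" if "i \<in> {1..k}" for i
  proof -
    have "h i + h' i = (\<Sum>j\<in>{1..k}. of_bool (j \<noteq> i))"
      unfolding h_def h'_def sum.distrib[symmetric] by (intro sum.cong) auto
    also have "\<dots> = of_nat (card ({1..k} - {i}))"
      by (simp add: sum_of_bool_eq Int_def set_diff_eq)
    finally show ?thesis using that by simp
  qed
  have c_in: "c e \<in> {1..k}" if "e \<in> E" for e
  proof -
    obtain a b where "e = {a, b}" "a \<in> V" using edgeE[OF \<open>e \<in> E\<close>] by metis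
    then have "e \<in> ?I a" using that by (auto simp: incident_edges_def)
    then show ?thesis using bij[OF \<open>a \<in> V\<close>] by (auto simp: bij_betw_def)
  qed
  have ends: "(\<Sum>s\<in>e. before s (other_end e s)) = 1" "(\<Sum>s\<in>e. before (other_end e s) s) = 1"
    if e: "e \<in> E" for e
  proof -
    obtain a b where ab: "e = {a, b}" "label a < label b" using edgeE[OF e] by metis
    then have "a \<noteq> b" by auto
    then show "(\<Sum>s\<in>e. before s (other_end e s)) = 1" "(\<Sum>s\<in>e. before (other_end e s) s) = 1"
      using ab by (auto simp: before_def)
  qed

  have "(\<Sum>e\<in>E. \<Sum>f\<in>E. ?o e f * of_bool (edges_intersect n v e f)) =
      (\<Sum>e\<in>E. \<Sum>f\<in>E. ?o e f * (\<Sum>x\<in>e. \<Sum>y\<in>f. before y x)) +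
      (\<Sum>e\<in>E. \<Sum>f\<in>E. ?o e f * (\<Sum>s\<in>e \<inter> f. ?g s e f))"
    (is "_ = ?A + ?B")
    unfolding sum.distrib[symmetric] distrib_left[symmetric]
  proof (intro sum.cong refl)
    fix e f assume ef: "e \<in> E" "f \<in> E"
    show "?o e f * of_bool (edges_intersect n v e f) =
        ?o e f * ((\<Sum>x\<in>e. \<Sum>y\<in>f. before y x) + (\<Sum>s\<in>e \<inter> f. ?g s e f))"
    \<comment> \<open>The factor \<open>?o e f\<close> vanishes unless \<open>c e < c f\<close>, so
      the parity formula is applied only to distinct edges.\<close>
    proof (cases "c e < c f")
      case True
      then have "e \<noteq> f" by auto
      show ?thesis by (simp only: edges_intersect_parity[OF ef \<open>e \<noteq> f\<close>])
    qed simp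
  qed
  \<comment> \<open>As the two edges run over those at \<open>x\<close> and at \<open>y\<close>,
    their colors range independently over \<open>{1..k}\<close>.\<close>
  also have "?A = (\<Sum>x\<in>V. \<Sum>y\<in>V. before y x * (\<Sum>i\<in>{1..k}. \<Sum>j\<in>{1..k}. of_bool (i < j)))"
  proof -
    have "?A = (\<Sum>e\<in>E. \<Sum>x\<in>e. \<Sum>f\<in>E. \<Sum>y\<in>f. ?o e f * before y x)"
      unfolding sum_distrib_left by (intro sum.cong refl sum.swap)
    also have "\<dots> = (\<Sum>x\<in>V. \<Sum>e\<in>?I x. \<Sum>y\<in>V. \<Sum>f\<in>?I y. ?o e f * before y x)"
      unfolding sum_edges_vertices ..
    also have "\<dots> = (\<Sum>x\<in>V. \<Sum>y\<in>V. \<Sum>e\<in>?I x. \<Sum>f\<in>?I y. ?o e f * before y x)"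
      by (intro sum.cong refl sum.swap)
    also have "\<dots> = (\<Sum>x\<in>V. \<Sum>y\<in>V. before y x * (\<Sum>e\<in>?I x. \<Sum>f\<in>?I y. ?o e f))"
      by (simp add: sum_distrib_left mult.commute)
    also have "\<dots> = (\<Sum>x\<in>V. \<Sum>y\<in>V. before y x * (\<Sum>i\<in>{1..k}. \<Sum>j\<in>{1..k}. of_bool (i < j)))"
    proof (intro sum.cong refl arg_cong[of _ _ "(*) _"])
      fix x y assume xy: "x \<in> V" "y \<in> V"
      have "(\<Sum>e\<in>?I x. \<Sum>f\<in>?I y. ?o e f) = (\<Sum>e\<in>?I x. \<Sum>j\<in>{1..k}. of_bool (c e < j))"
        using re[OF xy(2), of "\<lambda>j. of_bool (_ < j)"] by simp
      also have "\<dots> = (\<Sum>i\<in>{1..k}. \<Sum>j\<in>{1..k}. of_bool (i < j))"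
        using re[OF xy(1), of "\<lambda>i. \<Sum>j\<in>{1..k}. of_bool (i < j)"] by simp
      finally show "(\<Sum>e\<in>?I x. \<Sum>f\<in>?I y. ?o e f) = (\<Sum>i\<in>{1..k}. \<Sum>j\<in>{1..k}. of_bool (i < j))" .
    qed
    finally show ?thesis .
  qed
  also have "?B = (\<Sum>s\<in>V. \<Sum>e\<in>?I s. \<Sum>f\<in>?I s. ?o e f * ?g s e f)"
  proof -
    \<comment> \<open>Turning membership of \<open>s\<close> in \<open>f\<close> into a factor frees
      the range of \<open>s\<close> from \<open>f\<close>, so the sums can be swapped.\<close>
    have "?B = (\<Sum>e\<in>E. \<Sum>f\<in>E. \<Sum>s\<in>e. of_bool (s \<in> f) * (?o e f * ?g s e f))"
      unfolding sum_distrib_left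
      by (intro sum.cong refl sum.mono_neutral_cong_left) auto
    also have "\<dots> = (\<Sum>e\<in>E. \<Sum>s\<in>e. \<Sum>f\<in>E. of_bool (s \<in> f) * (?o e f * ?g s e f))"
      by (intro sum.cong refl sum.swap)
    also have "\<dots> = (\<Sum>s\<in>V. \<Sum>e\<in>?I s. \<Sum>f\<in>E. of_bool (s \<in> f) * (?o e f * ?g s e f))"
      by (rule sum_edges_vertices)
    also have "\<dots> = (\<Sum>s\<in>V. \<Sum>e\<in>?I s. \<Sum>f\<in>?I s. ?o e f * ?g s e f)"
      by (intro sum.cong refl sum.mono_neutral_cong_right) (auto simp: incident_edges_def)
    finally show ?thesis .
  qed
  also have "\<dots> = (\<Sum>s\<in>V. \<Sum>e\<in>?I s. \<Sum>f\<in>?I s. ?o e f * before s (other_end e s)) +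
      (\<Sum>s\<in>V. \<Sum>e\<in>?I s. \<Sum>f\<in>?I s. ?o e f * before (other_end f s) s) +
      (\<Sum>s\<in>V. \<Sum>e\<in>?I s. \<Sum>f\<in>?I s. ?o e f * before (other_end f s) (other_end e s))"
    (is "_ = ?C + ?D + ?F")
    by (simp add: sum.distrib distrib_left)
  \<comment> \<open>Modulo 2, \<open>h (c e)\<close> edges at \<open>s\<close> have a larger color
    than \<open>e\<close>; of the two ends of \<open>e\<close>, only the one with the smaller label
    counts. For \<open>?D\<close> it is the end of \<open>f\<close> with the larger label.\<close>
  also have "?C = (\<Sum>e\<in>E. h (c e))"
  proof -
    have "?C = (\<Sum>s\<in>V. \<Sum>e\<in>?I s. h (c e) * before s (other_end e s))"
      unfolding sum_distrib_right[symmetric] h_def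
      using re[of _ "\<lambda>j. of_bool (_ < j)"] by (intro sum.cong refl) simp
    also have "\<dots> = (\<Sum>e\<in>E. h (c e) * (\<Sum>s\<in>e. before s (other_end e s)))"
      unfolding sum_edges_vertices[symmetric] sum_distrib_left ..
    finally show ?thesis by (simp add: ends)
  qed
  also have "?D = (\<Sum>e\<in>E. h' (c e))"
  proof -
    have "?D = (\<Sum>s\<in>V. \<Sum>f\<in>?I s. \<Sum>e\<in>?I s. ?o e f * before (other_end f s) s)"
      by (intro sum.cong refl sum.swap)
    also have "\<dots> = (\<Sum>s\<in>V. \<Sum>f\<in>?I s. h' (c f) * before (other_end f s) s)"
      unfolding sum_distrib_right[symmetric] h'_def
      using re[of _ "\<lambda>i. of_bool (i < _)"] by (intro sum.cong refl) simp
    also have "\<dots> = (\<Sum>f\<in>E. h' (c f) * (\<Sum>s\<in>f. before (other_end f s) s))"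
      unfolding sum_edges_vertices[symmetric] sum_distrib_left ..
    finally show ?thesis by (simp add: ends)
  qed
  also have "(\<Sum>e\<in>E. h (c e)) + (\<Sum>e\<in>E. h' (c e)) = of_nat (card E * (k - 1))"
  proof -
    have "(\<Sum>e\<in>E. h (c e) + h' (c e)) = (\<Sum>e\<in>E. of_nat (k - 1))"
      by (intro sum.cong refl hh c_in)
    then show ?thesis by (simp only: sum.distrib sum_constant of_nat_mult)
  qed
  also have "?F = (\<Sum>s\<in>V. inversion_parity (?I s) (\<lambda>e. label (other_end e s)) c)"
    unfolding inversion_parity_def before_def of_bool_conj ..
  finally show ?thesis by (simp only: add.assoc)
qed

section \<open>Crossings sorted by color\<close>

text \<open>A crossing pair of equally colored edges determines its color, so the sum over the
  colors is the size of a disjoint union.\<close>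

lemma int_coloring_eq_card:
  assumes "c \<in> E \<rightarrow> {1..k}"
  shows "int_coloring n v k E c =
    card {{e, f} | e f. e \<in> E \<and> f \<in> E \<and> c e = c f \<and> edges_intersect n v e f}"
proof -
  let ?S = "\<lambda>i. {{e, f} | e f. e \<in> color_class E c i \<and> f \<in> color_class E c i \<and>
    edges_intersect n v e f}"
  have "{{e, f} | e f. e \<in> E \<and> f \<in> E \<and> c e = c f \<and> edges_intersect n v e f} =
      (\<Union>i\<in>{1..k}. ?S i)" (is "?L = ?R")
  proof (rule Set.set_eqI, rule iffI)
    fix X assume "X \<in> ?L"
    then obtain e f where X: "X = {e, f}" "e \<in> E" "f \<in> E" "c e = c f" "edges_intersect n v e f"
      by blast
    then have "X \<in> ?S (c e)" by (auto simp: color_class_def)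
    moreover have "c e \<in> {1..k}" using assms X by auto
    ultimately show "X \<in> ?R" by blast
  next
    fix X assume "X \<in> ?R"
    then obtain i e f where "X = {e, f}" "e \<in> color_class E c i" "f \<in> color_class E c i"
        "edges_intersect n v e f"
      by blast
    then have "X = {e, f} \<and> e \<in> E \<and> f \<in> E \<and> c e = c f \<and> edges_intersect n v e f"
      by (simp add: color_class_def)
    then show "X \<in> ?L" by blast
  qed
  moreover have "card (\<Union>i\<in>{1..k}. ?S i) = (\<Sum>i\<in>{1..k}. card (?S i))"
  proof (rule card_UN_disjoint)
    show "\<forall>i\<in>{1..k}. finite (?S i)"
    proof
      fix i
      have "?S i \<subseteq> Pow E" by (auto simp: color_class_def)
      then show "finite (?S i)" by (rule finite_subset) simp
    qed
    show "\<forall>i\<in>{1..k}. \<forall>j\<in>{1..k}. i \<noteq> j \<longrightarrow> ?S i \<inter> ?S j = {}"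
      by (auto simp: color_class_def doubleton_eq_iff)
  qed simp
  ultimately show ?thesis
    by (simp add: int_coloring_def int_factor_def)
qed

text \<open>Here \<open>int_factor\<close> is applied to the whole edge set, as the total crossing
  number of the graph. Crossing pairs of different colors are oriented by increasing color, which
  makes them correspond to ordered pairs.\<close>

lemma int_factor_all_edges:
  assumes "c \<in> E \<rightarrow> {1..k}"
  shows "of_nat (int_factor n v E) = of_nat (int_coloring n v k E c) +
    (\<Sum>e\<in>E. \<Sum>f\<in>E. of_bool (c e < c f) * of_bool (edges_intersect n v e f) :: bit)"
proof -
  let ?M = "{{e, f} | e f. e \<in> E \<and> f \<in> E \<and> c e = c f \<and> edges_intersect n v e f}"
  let ?O = "{(e, f). e \<in> E \<and> f \<in> E \<and> c e < c f \<and> edges_intersect n v e f}"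
  let ?B = "(\<lambda>(e, f). {e, f}) ` ?O"
  have "{{e, f} | e f. e \<in> E \<and> f \<in> E \<and> edges_intersect n v e f} = ?M \<union> ?B" (is "?L = _")
  proof (rule Set.set_eqI, rule iffI)
    fix X assume "X \<in> ?L"
    then obtain e f where X: "X = {e, f}" "e \<in> E" "f \<in> E" "edges_intersect n v e f" by blast
    consider "c e = c f" | "c e < c f" | "c f < c e" by linarith
    then show "X \<in> ?M \<union> ?B"
    proof cases
      case 3
      then have "(f, e) \<in> ?O" using X edges_intersect_sym by auto
      then have "{f, e} \<in> ?B" by force
      then show ?thesis using X by (simp add: insert_commute)
    qed (use X in force)+
  next
    fix X assume "X \<in> ?M \<union> ?B"
    then show "X \<in> ?L" by auto
  qed
  moreover have "card (?M \<union> ?B) = card ?M + card ?B"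
  proof (rule card_Un_disjoint)
    show "finite ?M" "finite ?B"
      by (auto intro!: finite_subset[of _ "Pow E"])
    show "?M \<inter> ?B = {}"
      by (auto simp: doubleton_eq_iff)
  qed
  moreover have "card ?B = card ?O"
    by (rule card_image) (auto simp: inj_on_def doubleton_eq_iff)
  ultimately have "int_factor n v E = int_coloring n v k E c + card ?O"
    by (simp add: int_factor_def int_coloring_eq_card[OF assms])
  moreover have "of_nat (card ?O) =
      (\<Sum>e\<in>E. \<Sum>f\<in>E. of_bool (c e < c f) * of_bool (edges_intersect n v e f) :: bit)"
  proof -
    have "?O = E \<times> E \<inter> {ef. c (fst ef) < c (snd ef) \<and> edges_intersect n v (fst ef) (snd ef)}"
      by auto
    then have "of_nat (card ?O) = (\<Sum>ef\<in>E \<times> E.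
        of_bool (c (fst ef) < c (snd ef) \<and> edges_intersect n v (fst ef) (snd ef)) :: bit)"
      by (simp add: sum_of_bool_eq)
    then show ?thesis
      by (simp only: sum.cartesian_product case_prod_unfold of_bool_conj)
  qed
  ultimately show ?thesis by simp
qed

section \<open>Signs of colorings and of 1-factorizations\<close>

lemma bij_betw_proper_edge_coloring:
  assumes "regular_graph k V E" "proper_edge_coloring k E c" "x \<in> V"
  shows "bij_betw c (incident_edges E x) {1..k}"
proof -
  have "inj_on c (incident_edges E x)"
    using assms(2) unfolding proper_edge_coloring_def inj_on_def incident_edges_def by blast
  moreover have "c ` incident_edges E x \<subseteq> {1..k}"
    using assms(2) by (auto simp: proper_edge_coloring_def incident_edges_def)
  moreover have "card (incident_edges E x) = k"
    using assms(1,3) by (simp add: regular_graph_def)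
  ultimately show ?thesis
    unfolding bij_betw_def by (metis card_atLeastAtMost card_image card_subset_eq
      diff_Suc_1 finite_atLeastAtMost)
qed

text \<open>Total inversions and \<open>int_coloring\<close> differ by the same constant
  \<open>K\<close> for \<open>c\<close> and for \<open>c0\<close>; \<open>K\<close> occurs twice in
  the relative sign and cancels modulo 2.\<close>

lemma sgn_coloring_eq:
  assumes regular: "regular_graph k V E"
    and c0: "proper_edge_coloring k E c0" and c: "proper_edge_coloring k E c"
  shows "sgn_coloring n v k V E c0 c = (- 1) ^ int_coloring n v k E c"
proof -
  \<comment> \<open>Inversion parity at a vertex, not the inverse function.\<close>
  define inv where "inv = (\<lambda>(d :: 'a set \<Rightarrow> nat) s.
    inversion_parity (incident_edges E s) (\<lambda>e. label (other_end e s)) d)"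
  define K where "K = of_nat (int_factor n v E) +
    ((\<Sum>x\<in>V. \<Sum>y\<in>V. before y x * (\<Sum>i\<in>{1..k}. \<Sum>j\<in>{1..k}. of_bool (i < j))) +
    of_nat (card E * (k - 1)))"
  have sum_inv: "(\<Sum>s\<in>V. inv d s) = of_nat (int_coloring n v k E d) + K"
    if d: "proper_edge_coloring k E d" for d
  proof -
    have "d \<in> E \<rightarrow> {1..k}" using d by (simp add: proper_edge_coloring_def)
    from int_factor_all_edges[OF this]
      bicolored_intersections_parity[OF bij_betw_proper_edge_coloring[OF regular d]]
    show ?thesis
      unfolding K_def inv_def by (simp add: algebra_simps)
  qed
  have "sgn_rel V E c c0 = (\<Prod>s\<in>V. parity_sign (inv c s) * parity_sign (inv c0 s))"
    unfolding sgn_rel_def sgn_vertex_def inv_def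
    by (intro prod.cong refl sign_on_inv_into_comp[where K = "{1..k}"]
        bij_betw_proper_edge_coloring[OF regular] c c0 inj_on_other_end) auto
  also have "\<dots> = parity_sign ((\<Sum>s\<in>V. inv c s) + (\<Sum>s\<in>V. inv c0 s))"
    by (simp add: parity_sign_add parity_sign_sum prod.distrib)
  also have "(\<Sum>s\<in>V. inv c s) + (\<Sum>s\<in>V. inv c0 s) =
      of_nat (int_coloring n v k E c) + of_nat (int_coloring n v k E c0) + (K + K)"
    unfolding sum_inv[OF c] sum_inv[OF c0] by (simp only: add_ac)
  finally have "sgn_rel V E c c0 = (- 1) ^ int_coloring n v k E c * (- 1) ^ int_coloring n v k E c0"
    by (simp add: parity_sign_add parity_sign_of_nat)
  \<comment> \<open>The sign of \<open>c0\<close> now occurs squared.\<close>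
  then show ?thesis
    by (simp add: sgn_coloring_def mult.assoc flip: power_mult_distrib)
qed

text \<open>The definite description requires a coloring with classes \<open>F\<close> and the same
  sign for all such colorings. Numbering the factors gives the first; \<open>sgn_coloring_eq\<close>
  gives the second, as the product over \<open>F\<close> ignores the numbering.\<close>

lemma sgn_factorization_eq:
  assumes regular: "regular_graph k V E" and c0: "proper_edge_coloring k E c0"
    and F: "one_factorization k V E F"
  shows "sgn_factorization n v k V E c0 F = (\<Prod>M\<in>F. sgn_factor n v M)"
proof -
  have part: "partition_on E F" and card: "card F = k"
    and factor: "\<And>M. M \<in> F \<Longrightarrow> one_factor V E M"
    using F by (auto simp: one_factorization_def)
  have "finite F"
    using part finite_E finite_UnionD unfolding partition_on_def by metis
  then obtain M where M: "bij_betw M {1..k} F"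
    using card ex_bij_betw_nat_finite_1 by metis
  have in_F: "M i \<in> F" if "i \<in> {1..k}" for i
    using M that by (auto simp: bij_betw_def)
  have ex1: "\<exists>!i. i \<in> {1..k} \<and> e \<in> M i" if "e \<in> E" for e
  proof -
    obtain N where N: "N \<in> F" "e \<in> N"
      using part \<open>e \<in> E\<close> by (auto simp: partition_on_def)
    then obtain i where i: "i \<in> {1..k}" "M i = N"
      using M by (auto simp: bij_betw_def)
    show ?thesis
    proof (rule ex1I[of _ i])
      show "i \<in> {1..k} \<and> e \<in> M i" using i N by simp
    next
      fix j assume j: "j \<in> {1..k} \<and> e \<in> M j"
      then have "M j = M i"
        using disjointD[of F "M j" "M i"] part in_F i N by (auto simp: partition_on_def)
      then show "j = i" using M i j unfolding bij_betw_def by (meson inj_onD)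
    qed
  qed
  define c where "c = (\<lambda>e. THE i. i \<in> {1..k} \<and> e \<in> M i)"
  have c: "c e \<in> {1..k} \<and> e \<in> M (c e)" if "e \<in> E" for e
    unfolding c_def by (rule theI') (rule ex1[OF that])
  have c_unique: "c e = i" if "e \<in> E" "i \<in> {1..k}" "e \<in> M i" for e i
    using ex1[OF that(1)] c[OF that(1)] that by blast
  have class_c: "color_class E c i = M i" if i: "i \<in> {1..k}" for i
  proof -
    have "M i \<subseteq> E"
      using factor[OF in_F[OF i]] by (simp add: one_factor_def)
    moreover have "c e = i \<longleftrightarrow> e \<in> M i" if "e \<in> E" for e
      using c[OF that] c_unique[OF that i] by blast
    ultimately show ?thesis unfolding color_class_def by blast
  qed
  have proper: "proper_edge_coloring k E c"
    unfolding proper_edge_coloring_def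
  proof (intro conjI ballI impI notI)
    show "c \<in> E \<rightarrow> {1..k}" using c by auto
  next
    fix e f assume ef: "e \<in> E" "f \<in> E" "e \<noteq> f \<and> e \<inter> f \<noteq> {}" "c e = c f"
    then obtain x where x: "x \<in> e" "x \<in> f" "x \<in> V" using edge_subset by blast
    have "one_factor V E (M (c e))" using factor in_F c[OF ef(1)] by simp
    moreover have "e \<in> M (c e)" "f \<in> M (c e)" using c[OF ef(1)] c[OF ef(2)] ef(4) by simp_all
    ultimately show False using x ef(3) unfolding one_factor_def by blast
  qed
  have image: "color_class E c ` {1..k} = F"
    using M class_c by (simp add: bij_betw_def)
  have sgn: "sgn_coloring n v k V E c0 d = (\<Prod>M\<in>F. sgn_factor n v M)"
    if "proper_edge_coloring k E d" "color_class E d ` {1..k} = F" for d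
  proof -
    \<comment> \<open>\<open>k\<close> colors are mapped onto \<open>k\<close> factors, so the
      product over \<open>F\<close> can be reindexed by colors.\<close>
    have "inj_on (color_class E d) {1..k}"
      using that(2) card by (intro eq_card_imp_inj_on) auto
    then have "(\<Prod>M\<in>F. sgn_factor n v M) = (\<Prod>i\<in>{1..k}. sgn_factor n v (color_class E d i))"
      unfolding that(2)[symmetric] by (subst prod.reindex) auto
    also have "\<dots> = (- 1) ^ int_coloring n v k E d"
      by (simp add: sgn_factor_def int_coloring_def power_sum)
    finally show ?thesis
      using sgn_coloring_eq[OF regular c0 that(1)] by simp
  qed
  show ?thesis
    unfolding sgn_factorization_def
  proof (rule the_equality)
    show "\<exists>c. proper_edge_coloring k E c \<and> color_class E c ` {1..k} = F \<and>
        (\<Prod>M\<in>F. sgn_factor n v M) = sgn_coloring n v k V E c0 c"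
      using proper image sgn[OF proper image] by (intro exI[of _ c]) simp
  qed (auto dest: sgn)
qed

section \<open>Straight-line drawings\<close>

text \<open>Labels and angles are ordered alike. Up to exchanging the edges, the lowest label
  belongs to \<open>e\<close>, which leaves three patterns: separated, crossing and nested
  chords.\<close>

lemma edges_intersect_iff_segments_meet:
  assumes circle: "consecutive_on_circle n v P" and ef: "e \<in> E" "f \<in> E" "e \<inter> f = {}"
  shows "edges_intersect n v e f \<longleftrightarrow> convex hull (P ` e) \<inter> convex hull (P ` f) \<noteq> {}"
proof -
  obtain z r \<theta> where r: "r > 0"
    and P: "\<And>i. i \<in> {1..2*n} \<Longrightarrow> P (v i) = z + of_real r * cis (\<theta> i)"
    and \<theta>: "\<And>i j. i \<in> {1..2*n} \<Longrightarrow> j \<in> {1..2*n} \<Longrightarrow> i < j \<Longrightarrow> \<theta> i < \<theta> j \<and> \<theta> j < \<theta> i + 2 * pi"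
    using circle unfolding consecutive_on_circle_def by blast
  define T where "T x = \<theta> (label x)" for x
  have P': "P x = z + of_real r * cis (T x)" if "x \<in> V" for x
    using P[OF label_in[OF that]] that by (simp add: T_def)
  have T: "T x < T y \<and> T y < T x + 2 * pi" if "x \<in> V" "y \<in> V" "label x < label y" for x y
    using \<theta> that label_in by (simp add: T_def)
  have hull: "convex hull (P ` {x, y}) = closed_segment (P x) (P y)" for x y
    by (simp add: segment_convex_hull)
  \<comment> \<open>The underscores stay schematic, to be filled with vertices; the facts are
    crossing, separated and nested, in this order.\<close>
  note chords = chords_of_circle[OF r, of "T _" "T _" "T _" "T _" z]
  have main: "(edges_intersect n v {a, b} {p, q} \<longleftrightarrow>
      closed_segment (P a) (P b) \<inter> closed_segment (P p) (P q) \<noteq> {})"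
    if V: "a \<in> V" "b \<in> V" "p \<in> V" "q \<in> V" and lab: "label a < label b" "label p < label q"
      "label a < label p" and "b \<noteq> p" "b \<noteq> q" for a b p q
  proof -
    have "label b \<noteq> label p" "label b \<noteq> label q"
      using V \<open>b \<noteq> p\<close> \<open>b \<noteq> q\<close> inj_on_label by (auto simp: inj_on_def)
    then consider "label b < label p" | "label p < label b" "label b < label q" | "label q < label b"
      by linarith
    then show ?thesis
    proof cases
      case 1
      then show ?thesis
        using chords(2)[of a b p q] T V lab by (simp add: edges_intersect_iff P')
    next
      case 2
      then show ?thesis
        using chords(1)[of a p b q] T V lab by (simp add: edges_intersect_iff P')
    next
      case 3
      then show ?thesis
        using chords(3)[of a p q b] T V lab by (simp add: edges_intersect_iff P')
    qed
  qed
  obtain a b where e: "e = {a, b}" "a \<in> V" "b \<in> V" "label a < label b"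
    using edgeE[OF ef(1)] by metis
  obtain p q where f: "f = {p, q}" "p \<in> V" "q \<in> V" "label p < label q"
    using edgeE[OF ef(2)] by metis
  have ne: "a \<noteq> p" "a \<noteq> q" "b \<noteq> p" "b \<noteq> q" using ef(3) e f by auto
  then have "label a \<noteq> label p"
    using e f inj_on_label by (auto simp: inj_on_def)
  then consider "label a < label p" | "label p < label a" by linarith
  then show ?thesis
  proof cases
    case 1
    then show ?thesis
      unfolding e(1) f(1) hull using e(2-) f(2-) ne by (intro main) auto
  next
    case 2
    then have "edges_intersect n v f e \<longleftrightarrow>
        closed_segment (P p) (P q) \<inter> closed_segment (P a) (P b) \<noteq> {}"
      unfolding e(1) f(1) using e(2-) f(2-) ne by (intro main) auto
    moreover have "edges_intersect n v e f \<longleftrightarrow> edges_intersect n v f e"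
      using edges_intersect_sym by blast
    ultimately show ?thesis
      unfolding e(1) f(1) hull by (simp add: Int_commute)
  qed
qed

text \<open>Distinct edges of equal color are disjoint by properness, so the geometric criterion
  applies to them.\<close>

lemma int_coloring_eq_drawn_intersections:
  assumes c: "proper_edge_coloring k E c" and circle: "consecutive_on_circle n v P"
  shows "int_coloring n v k E c = drawn_intersections P E c"
proof -
  have "edges_intersect n v e f \<longleftrightarrow>
      e \<noteq> f \<and> convex hull (P ` e) \<inter> convex hull (P ` f) \<noteq> {}"
    if "e \<in> E" "f \<in> E" "c e = c f" for e f
  proof (cases "e = f")
    case True
    then show ?thesis using edges_intersect_irrefl that by simp
  next
    case False
    then have "e \<inter> f = {}"
      using c that unfolding proper_edge_coloring_def by blast
    then show ?thesis
      using edges_intersect_iff_segments_meet[OF circle that(1,2)] False by simp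
  qed
  then have "e \<in> E \<and> f \<in> E \<and> c e = c f \<and> edges_intersect n v e f \<longleftrightarrow>
      e \<in> E \<and> f \<in> E \<and> e \<noteq> f \<and> c e = c f \<and>
        convex hull (P ` e) \<inter> convex hull (P ` f) \<noteq> {}" for e f
    by metis
  moreover have "c \<in> E \<rightarrow> {1..k}" using c by (simp add: proper_edge_coloring_def)
  ultimately show ?thesis
    by (simp only: int_coloring_eq_card drawn_intersections_def)
qed

end

theorem theorem2:
  fixes V :: "'a set" and E :: "'a set set" and v :: "nat \<Rightarrow> 'a"
    and n k :: nat and c0 :: "'a set \<Rightarrow> nat"
  assumes "bij_betw v {1..2*n} V"
    and "regular_graph k V E"
    and "proper_edge_coloring k E c0"
  shows "(\<forall>F. one_factorization k V E F \<longrightarrow>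
              sgn_factorization n v k V E c0 F = (\<Prod>M\<in>F. sgn_factor n v M))
       \<and> (\<forall>c. proper_edge_coloring k E c \<longrightarrow>
              sgn_coloring n v k V E c0 c = (- 1) ^ int_coloring n v k E c \<and>
              (\<forall>P. consecutive_on_circle n v P \<longrightarrow>
                   int_coloring n v k E c = drawn_intersections P E c))"
proof -
  interpret labelled_graph V E v n
    using assms(1,2) by unfold_locales (auto simp: regular_graph_def)
  show ?thesis
    using sgn_factorization_eq[OF assms(2,3)] sgn_coloring_eq[OF assms(2,3)]
      int_coloring_eq_drawn_intersections by blast
qed

end
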